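(* There exists a constant $\epsilon>0$ such that the following holds for all sufficiently large $k$. Let $\varphi:=\neg\mathrm{ontoPHP}_k$, and let $B=(2,S,M,g)$ be a cellular automaton that is inverse to $A_\varphi$ on $\mathrm{Config}_{n,m}$, with $n,m$ and $S=S_{n,m}$ determined by $\varphi$. Let $\mu:=|M|$ be the size of the neighbourhood of $B$, and let $t$ be the size of $B$. Then $t\ge 2^{k^\epsilon}$. In particular, for all sufficiently large $k$, $\mu\ge k^\epsilon$.
   Context: The formula. $\neg\mathrm{ontoPHP}_k$ is the CNF formula in variables $p_{ij}$, $i\in[k+1]$, $j\in[k]$ (where $[r]=\{0,\dots,r-1\}$), with clauses: $\bigvee_j p_{ij}$ for each $i$; $\neg p_{i_1j}\vee\neg p_{i_2j}$ for each $i_1<i_2$ and $j$; $\neg p_{ij_1}\vee\neg p_{ij_2}$ for each $i$ and $j_1<j_2$; $\bigvee_i p_{ij}$ for each $j$. Its variables and clauses are enumerated in a fixed order as $x_1,\dots,x_m$ ($m=k(k+1)$) and $C_1,\dots,C_n$; if the number of clauses is even, a copy of the last clause is added so that $n$ is odd. Inverse and size. A cellular automaton $B=(2,S,M,g)$ has dimension 2, state set $S$, neighbourhood $M=(y_1,\dots,y_\mu)$ (distinct vectors of $\mathbb Z^2$, $\mu\ge1$), local function $g:S^\mu\to S$, and acts by $B(C)(p)=g(C(p+y_1),\dots,C(p+y_\mu))$. $B$ is inverse to $A_\varphi$ on $\mathrm{Config}_{n,m}$ if $B(A_\varphi(C))=C$ for all $C\in\mathrm{Config}_{n,m}$. The size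 of $B$ is the length of the binary string coding the table of $g$, which has $|S|^\mu$ rows, each value being coded by $\log|S|$ bits (so the size is bounded above by $|S|^\mu\log|S|$). States ($\square$ means "absent"). A state is $s=((i,j),\mathrm{flag},a,\mathsf{pd},\mathsf{pc},\mathrm{label})$, with components $\mathrm{coord}(s)=(i,j)$, $\mathrm{flag}(s)$, $a(s)$, $\mathsf{pd}(s)$, $\mathsf{pc}(s)$, $\mathrm{label}(s)$. $S_{n,m}$ consists of (with $\mathrm{label}\in\{0,1\}$ in (1)-(6)): (1) $((0,0),\square,\square,\square,\square,\mathrm{label})$; (2) $((i,0),\square,\square,\square,\square,\mathrm{label})$, $1\le i\le n$; (3) $((0,j),\square,a,\square,\square,\mathrm{label})$, $1\le j\le m$, $a\in\{0,1\}$; (4) $((0,m+1),\square,\square,\square,\square,\mathrm{label})$; (5) $((i,m+1),\square,\square,\square,\mathsf{pc},\mathrm{label})$, $1\le i\le n$, $\mathsf{pc}\in\{0,1\}$; (6) $((i,j),\mathrm{flag},a,\mathsf{pd},\square,\mathrm{label})$, $1\le i\le n$, $1\le j\le m$, $\mathrm{flag}\in\{-1,0,1\}$, $a,\mathsf{pd}\in\{0,1\}$; (7) the quiescent state $\mathbf q=((\square,\square),\square,\square,\square,\square,\square)$. $\mathrm{Config}_{n,m}$ is the set of maps $C:\mathbb Z^2\to S_{n,m}$ with $C(p)\ne\mathbf q$ for $p\in[n+1]\times[m+2]$ and $C(p)=\mathbf q$ otherwise. The right, left, below, above neighbours of $p$ are $p+(0,1),p+(0,-1),p+(1,0),p+(-1,0)$.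 Local correctness. Let $s_1\neq\mathbf q$, $\mathrm{coord}(s_1)=(i,j)$, and let $s_2,s_3,s_4,s_5$ be the states of the right, left, below, above neighbours. $s_1$ is locally correct with respect to $s_2,\dots,s_5$ if: (A) for each $(k',d)$ among $(2,(0,1)),(3,(0,-1)),(4,(1,0)),(5,(-1,0))$: if $(i,j)+d\in[n+1]\times[m+2]$ then $\mathrm{coord}(s_{k'})=(i,j)+d$; otherwise $s_{k'}=\mathbf q$; (B) if $1\le i\le n$, $1\le j\le m$: $\mathrm{flag}(s_1)=1$ iff $x_j\in C_i$, $\mathrm{flag}(s_1)=-1$ iff $\neg x_j\in C_i$, $\mathrm{flag}(s_1)=0$ iff neither; (C1) if $1\le j\le m$: $a(s_{l})=a(s_1)$ for $l\in\{4,5\}$ with $s_{l}\ne\mathbf q$; (C2) if $j=m+1$, $i\ge2$: $\mathsf{pc}(s_1)=\mathsf{pc}(s_5)\wedge\mathsf{pd}(s_3)$; (C3) if $(i,j)=(1,m+1)$: $\mathsf{pc}(s_1)=1$ iff $\mathsf{pd}(s_3)=1$; (D1) if $1\le i\le n$, $2\le j\le m$: $\mathsf{pd}(s_1)=1$ iff $\mathsf{pd}(s_3)=1$ or ($\mathrm{flag}(s_1)=1$, $a(s_1)=1$) or ($\mathrm{flag}(s_1)=-1$, $a(s_1)=0$); (D2) if $1\le i\le n$, $j=1$: $\mathsf{pd}(s_1)=1$ iff ($\mathrm{flag}(s_1)=1$, $a(s_1)=1$) or ($\mathrm{flag}(s_1)=-1$, $a(s_1)=0$); (E) components not used by the type (1)-(6)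 belonging to $(i,j)$ are $\square$ (automatic from $S_{n,m}$). $s_1$ is blue if it is locally correct and, if $\mathrm{coord}(s_1)=(n,m+1)$, also $\mathsf{pc}(s_1)=1$; otherwise (including $s_1=\mathbf q$) it is red. Successor. For $(i,j)\in[n+1]\times[m+2]$, $\mathrm{suc}(i,j)$ is given by the first applicable case: $(i,j+1)$ if $(i,j)=(0,0)$ or ($i$ even, $1\le j\le m$); $(i,j-1)$ if $(i,j)=(n,1)$ or ($i$ odd, $2\le j\le m+1$); $(i+1,j)$ if ($i$ odd, $j=1$) or ($i$ even, $j=m+1$); $(i-1,j)$ if $i\ge1$, $j=0$. If $s_1$ is blue, its successor is the unique $s_l$, $l\in\{2,3,4,5\}$, with $\mathrm{coord}(s_l)=\mathrm{suc}(\mathrm{coord}(s_1))$. Automaton. $A_\varphi=(2,S_{n,m},N,f_\varphi)$ with $N=((0,0),(0,1),(0,-1),(1,0),(-1,0))$; $f_\varphi(s_1,\dots,s_5)=s_1$ if $s_1$ is red, and otherwise it is $s_1$ with label replaced by $\mathrm{label}(s_1)\oplus\mathrm{label}(s_l)$, $s_l$ being the successor ($\oplus$ is addition mod 2). *)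

theory Defs
  imports Complex_Main "HOL-Library.Product_Plus" "HOL-Library.Countable_Set"
begin

section \<open>Two-dimensional cellular automata\<close>

text \<open>The dimension is fixed to 2 by the type of the neighbourhood vectors. A row of the
  table of the local function, an element of \<open>S\<^sup>\<mu>\<close>, is a list of length \<open>\<mu>\<close> over \<open>S\<close>; values of
  \<^term>\<open>loc\<close> on other lists are irrelevant.\<close>

record 's ca =
  states :: "'s set"
  nbhd :: "(int \<times> int) list"
  loc :: "'s list \<Rightarrow> 's"

definition rows :: "'s set \<Rightarrow> nat \<Rightarrow> 's list set" where
  "rows S \<mu> = {w. set w \<subseteq> S \<and> length w = \<mu>}"

definition is_ca :: "'s ca \<Rightarrow> bool" where
  "is_ca A \<longleftrightarrow> finite (states A) \<and> nbhd A \<noteq> [] \<and> distinct (nbhd A) \<and>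
     (\<forall>w \<in> rows (states A) (length (nbhd A)). loc A w \<in> states A)"

definition ca_step :: "'s ca \<Rightarrow> (int \<times> int \<Rightarrow> 's) \<Rightarrow> int \<times> int \<Rightarrow> 's" where
  "ca_step A C p = loc A (map (\<lambda>y. C (p + y)) (nbhd A))"

definition inverse_on :: "(int \<times> int \<Rightarrow> 's) set \<Rightarrow> 's ca \<Rightarrow> 's ca \<Rightarrow> bool" where
  "inverse_on Cs B A \<longleftrightarrow> (\<forall>C \<in> Cs. ca_step B (ca_step A C) = C)"

text \<open>The table of the local function is coded by concatenating, over all rows, the value of
  the row written in binary with \<open>\<lceil>log 2 (card S)\<rceil>\<close> bits. The numbering of the states and the
  order of the rows are arbitrary, and do not affect the length of the code.\<close>

definition code_width :: "'s set \<Rightarrow> nat" where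
  "code_width S = nat \<lceil>log 2 (real (card S))\<rceil>"

definition state_code :: "'s set \<Rightarrow> 's \<Rightarrow> bool list" where
  "state_code S s = map (bit (to_nat_on S s)) [0..<code_width S]"

definition table_code :: "'s ca \<Rightarrow> bool list" where
  "table_code A = concat (map (\<lambda>w. state_code (states A) (loc A w))
     (SOME ws. distinct ws \<and> set ws = rows (states A) (length (nbhd A))))"

definition ca_size :: "'s ca \<Rightarrow> nat" where
  "ca_size A = length (table_code A)"

lemma inj_on_state_code:
  assumes "finite S"
  shows "inj_on (state_code S) S"
proof (rule inj_onI)
  fix s t assume st: "s \<in> S" "t \<in> S" and eq: "state_code S s = state_code S t"
  have "card S > 0" using assms st card_gt_0_iff by blast
  then have "real (card S) = 2 powr (log 2 (real (card S)))" by simp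
  also have "\<dots> \<le> 2 powr real (code_width S)"
    unfolding code_width_def by (intro powr_mono) linarith+
  also have "\<dots> = real (2 ^ code_width S)" by (simp add: powr_realpow)
  finally have le: "card S \<le> 2 ^ code_width S" by linarith
  have lt: "to_nat_on S u < 2 ^ code_width S" if "u \<in> S" for u
    using bij_betwE[OF to_nat_on_finite[OF assms]] that le by fastforce
  have "bit (to_nat_on S s) i = bit (to_nat_on S t) i" if "i < code_width S" for i
    using eq that unfolding state_code_def by auto
  then have "take_bit (code_width S) (to_nat_on S s) = take_bit (code_width S) (to_nat_on S t)"
    by (intro bit_eqI) (auto simp: bit_take_bit_iff)
  then have "to_nat_on S s = to_nat_on S t"
    using lt st by (metis take_bit_nat_eq_self_iff)
  then show "s = t"
    using st assms inj_on_to_nat_on by (simp add: countable_finite inj_on_eq_iff)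
qed

lemma ca_size_eq:
  assumes "is_ca A"
  shows "ca_size A = card (states A) ^ length (nbhd A) * code_width (states A)"
proof -
  let ?R = "rows (states A) (length (nbhd A))"
  let ?ws = "SOME ws. distinct ws \<and> set ws = ?R"
  have fin: "finite (states A)" using assms by (simp add: is_ca_def)
  have "finite ?R" unfolding rows_def using finite_lists_length_eq[OF fin] by simp
  then have "\<exists>ws. distinct ws \<and> set ws = ?R" by (metis finite_distinct_list)
  then have ws: "distinct ?ws \<and> set ?ws = ?R" by (rule someI_ex)
  have "length ?ws = card ?R" using ws distinct_card by metis
  also have "\<dots> = card (states A) ^ length (nbhd A)"
    unfolding rows_def using card_lists_length_eq[OF fin] by simp
  finally show ?thesis
    by (simp add: ca_size_def table_code_def length_concat state_code_def comp_def sum_list_triv)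
qed


section \<open>The formula\<close>

datatype 'v literal = Pos 'v | Neg 'v

type_synonym 'v clause = "'v literal set"

definition php_vars :: "nat \<Rightarrow> (nat \<times> nat) set" where
  "php_vars k = {..<k+1} \<times> {..<k}"

text \<open>For \<open>k \<ge> 1\<close> the listed clauses are pairwise different as sets of literals, so a repetition-free
  listing of this set has one entry per clause of the formula.\<close>

definition not_onto_php :: "nat \<Rightarrow> (nat \<times> nat) clause set" where
  "not_onto_php k =
     {{Pos (i, j) |j. j < k} |i. i < k+1} \<union>
     {{Neg (i1, j), Neg (i2, j)} |i1 i2 j. i1 < i2 \<and> i2 < k+1 \<and> j < k} \<union>
     {{Neg (i, j1), Neg (i, j2)} |i j1 j2. i < k+1 \<and> j1 < j2 \<and> j2 < k} \<union>
     {{Pos (i, j) |i. i < k+1} |j. j < k}"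

definition enumerates :: "'b list \<Rightarrow> 'b set \<Rightarrow> bool" where
  "enumerates xs A \<longleftrightarrow> distinct xs \<and> set xs = A"

definition make_odd :: "'b list \<Rightarrow> 'b list" where
  "make_odd xs = (if even (length xs) then xs @ [last xs] else xs)"


section \<open>States and configurations\<close>

text \<open>An absent component is \<^term>\<open>None\<close>, and \<open>(\<box>,\<box>)\<close> is \<^term>\<open>None\<close> as well. The values
  0 and 1 of the assignment, \<open>pd\<close>, \<open>pc\<close> and label components are \<^term>\<open>False\<close> and
  \<^term>\<open>True\<close>.\<close>

datatype state = State
  (coord: "(int \<times> int) option")
  (flag: "int option")
  (asg: "bool option")
  (pd: "bool option")
  (pc: "bool option")
  (label: "bool option")

definition quiescent :: state where
  "quiescent = State None None None None None None"

definition S_states :: "nat \<Rightarrow> nat \<Rightarrow> state set" where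
  "S_states n m =
     {State (Some (0, 0)) None None None None (Some l) |l. True} \<union>
     {State (Some (i, 0)) None None None None (Some l) |i l. 1 \<le> i \<and> i \<le> int n} \<union>
     {State (Some (0, j)) None (Some a) None None (Some l) |j a l. 1 \<le> j \<and> j \<le> int m} \<union>
     {State (Some (0, int m + 1)) None None None None (Some l) |l. True} \<union>
     {State (Some (i, int m + 1)) None None None (Some c) (Some l) |i c l. 1 \<le> i \<and> i \<le> int n} \<union>
     {State (Some (i, j)) (Some fl) (Some a) (Some d) None (Some l) |i j fl a d l.
        1 \<le> i \<and> i \<le> int n \<and> 1 \<le> j \<and> j \<le> int m \<and> fl \<in> {-1, 0, 1}} \<union>
     {quiescent}"

definition grid :: "nat \<Rightarrow> nat \<Rightarrow> (int \<times> int) set" where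
  "grid n m = {0..int n} \<times> {0..int m + 1}"

definition Config :: "nat \<Rightarrow> nat \<Rightarrow> (int \<times> int \<Rightarrow> state) set" where
  "Config n m = {C. (\<forall>p. C p \<in> S_states n m) \<and> (\<forall>p. C p \<noteq> quiescent \<longleftrightarrow> p \<in> grid n m)}"


section \<open>The automaton of a formula\<close>

text \<open>A formula is given by the list \<open>X\<close> of its variables and the list \<open>F\<close> of its clauses, so
  \<open>m\<close> is the length of \<open>X\<close> and \<open>n\<close> that of \<open>F\<close>. Lists are read with indices starting at 1.\<close>

definition nth1 :: "'b list \<Rightarrow> int \<Rightarrow> 'b" where
  "nth1 xs i = xs ! nat (i - 1)"

text \<open>The condition that the flag (1 or -1) records a literal made true by the assignment.\<close>

definition lit_true :: "state \<Rightarrow> bool" where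
  "lit_true s \<longleftrightarrow> (flag s = Some 1 \<and> asg s = Some True) \<or> (flag s = Some (-1) \<and> asg s = Some False)"

text \<open>The arguments after \<open>s1\<close> are the right, left, below and above neighbours. That components
  unused by the type of \<open>s1\<close> are absent is already part of membership in
  \<^const>\<open>S_states\<close>.\<close>

definition locally_correct ::
  "'v list \<Rightarrow> 'v clause list \<Rightarrow> state \<Rightarrow> state \<Rightarrow> state \<Rightarrow> state \<Rightarrow> state \<Rightarrow> bool" where
  "locally_correct X F s1 s2 s3 s4 s5 \<longleftrightarrow>
     (let n = int (length F); m = int (length X) in
      s1 \<noteq> quiescent \<and>
      (\<exists>i j. coord s1 = Some (i, j) \<and>
        (\<forall>(s, d) \<in> {(s2, (0, 1)), (s3, (0, -1)), (s4, (1, 0)), (s5, (-1, 0))}.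
           if (i, j) + d \<in> grid (length F) (length X)
           then coord s = Some ((i, j) + d) else s = quiescent) \<and>
        (1 \<le> i \<and> i \<le> n \<and> 1 \<le> j \<and> j \<le> m \<longrightarrow>
           (flag s1 = Some 1 \<longleftrightarrow> Pos (nth1 X j) \<in> nth1 F i) \<and>
           (flag s1 = Some (-1) \<longleftrightarrow> Neg (nth1 X j) \<in> nth1 F i) \<and>
           (flag s1 = Some 0 \<longleftrightarrow> Pos (nth1 X j) \<notin> nth1 F i \<and> Neg (nth1 X j) \<notin> nth1 F i)) \<and>
        (1 \<le> j \<and> j \<le> m \<longrightarrow> (\<forall>s \<in> {s4, s5}. s \<noteq> quiescent \<longrightarrow> asg s = asg s1)) \<and>
        (j = m + 1 \<and> i \<ge> 2 \<longrightarrow>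
           (pc s1 = Some True \<longleftrightarrow> pc s5 = Some True \<and> pd s3 = Some True)) \<and>
        ((i, j) = (1, m + 1) \<longrightarrow> (pc s1 = Some True \<longleftrightarrow> pd s3 = Some True)) \<and>
        (1 \<le> i \<and> i \<le> n \<and> 2 \<le> j \<and> j \<le> m \<longrightarrow>
           (pd s1 = Some True \<longleftrightarrow> pd s3 = Some True \<or> lit_true s1)) \<and>
        (1 \<le> i \<and> i \<le> n \<and> j = 1 \<longrightarrow> (pd s1 = Some True \<longleftrightarrow> lit_true s1))))"

definition blue ::
  "'v list \<Rightarrow> 'v clause list \<Rightarrow> state \<Rightarrow> state \<Rightarrow> state \<Rightarrow> state \<Rightarrow> state \<Rightarrow> bool" where
  "blue X F s1 s2 s3 s4 s5 \<longleftrightarrow> locally_correct X F s1 s2 s3 s4 s5 \<and>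
     (coord s1 = Some (int (length F), int (length X) + 1) \<longrightarrow> pc s1 = Some True)"

text \<open>On the grid with \<open>n\<close> odd, the final case applies exactly to \<open>i \<ge> 1\<close>, \<open>j = 0\<close>.\<close>

definition suc_coord :: "nat \<Rightarrow> nat \<Rightarrow> int \<times> int \<Rightarrow> int \<times> int" where
  "suc_coord n m = (\<lambda>(i, j).
     if (i, j) = (0, 0) \<or> (even i \<and> 1 \<le> j \<and> j \<le> int m) then (i, j + 1)
     else if (i, j) = (int n, 1) \<or> (odd i \<and> 2 \<le> j \<and> j \<le> int m + 1) then (i, j - 1)
     else if (odd i \<and> j = 1) \<or> (even i \<and> j = int m + 1) then (i + 1, j)
     else (i - 1, j))"

definition successor ::
  "'v list \<Rightarrow> 'v clause list \<Rightarrow> state \<Rightarrow> state \<Rightarrow> state \<Rightarrow> state \<Rightarrow> state \<Rightarrow> state" where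
  "successor X F s1 s2 s3 s4 s5 =
     (THE s. s \<in> {s2, s3, s4, s5} \<and>
        coord s = Some (suc_coord (length F) (length X) (the (coord s1))))"

definition add_label :: "state \<Rightarrow> state \<Rightarrow> state" where
  "add_label s t = State (coord s) (flag s) (asg s) (pd s) (pc s)
     (Some (the (label s) \<noteq> the (label t)))"

definition local_rule :: "'v list \<Rightarrow> 'v clause list \<Rightarrow> state list \<Rightarrow> state" where
  "local_rule X F w = (case w of [s1, s2, s3, s4, s5] \<Rightarrow>
     (if blue X F s1 s2 s3 s4 s5 then add_label s1 (successor X F s1 s2 s3 s4 s5) else s1)
     | _ \<Rightarrow> undefined)"

definition automaton :: "'v list \<Rightarrow> 'v clause list \<Rightarrow> state ca" where
  "automaton X F = \<lparr>states = S_states (length F) (length X),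
     nbhd = [(0, 0), (0, 1), (0, -1), (1, 0), (-1, 0)],
     loc = local_rule X F\<rparr>"

definition is_inverse_ca :: "'v list \<Rightarrow> 'v clause list \<Rightarrow> state ca \<Rightarrow> bool" where
  "is_inverse_ca X F B \<longleftrightarrow> is_ca B \<and> states B = S_states (length F) (length X) \<and>
     inverse_on (Config (length F) (length X)) B (automaton X F)"

end

theory Submission
  imports Defs
begin

text \<open>
  On blue cells the automaton replaces each label by the difference of two consecutive labels
  along the successor path, so inverting it amounts to summing labels up to the next red cell,
  which is not a local operation. In row 0 the path runs from left to right. We keep this row
  blue between columns 1 and \<open>m\<close>, and make \<open>(0, 0)\<close> and all cells of row 1 below it red by
  wrong coordinates at \<open>(1, 0)\<close> and in row 2. Flipping the labels in columns \<open>1, \<dots>, r\<close> of row 0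
  then changes the image only at \<open>(0, r)\<close>, so an inverse automaton has to look at \<open>(0, r)\<close> in
  order to recover the label at \<open>(0, 1)\<close>. Hence \<open>\<mu> \<ge> m - 1\<close>, which gives the theorem
  with \<open>\<epsilon> = 1\<close>. The formula enters only through \<open>m\<close> and the fact that it has two clauses.
\<close>

text \<open>Has the right coordinates at \<open>(0, 0)\<close> and wrong ones at every other cell,
  so it can also serve as a filler that makes neighbouring cells red.\<close>

definition corner_state :: state where
  "corner_state = State (Some (0, 0)) None None None None (Some False)"

text \<open>Row 1 repeats the assignment value of row 0, as local correctness of the cells above it
  demands.\<close>

definition strip_config :: "nat \<Rightarrow> nat \<Rightarrow> int \<Rightarrow> int \<times> int \<Rightarrow> state" where
  "strip_config n m r = (\<lambda>(i, j).
     if (i, j) \<notin> grid n m then quiescent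
     else if i = 0 \<and> 1 \<le> j \<and> j \<le> int m
       then State (Some (0, j)) None (Some False) None None (Some (j \<le> r))
     else if i = 0 \<and> j = int m + 1
       then State (Some (0, j)) None None None None (Some False)
     else if i = 1 \<and> 1 \<le> j \<and> j \<le> int m
       then State (Some (1, j)) (Some 0) (Some False) (Some False) None (Some False)
     else corner_state)"

lemma strip_config_in_Config: "strip_config n m r \<in> Config n m"
proof -
  have "strip_config n m r (i, j) \<in> S_states n m" for i j
    unfolding strip_config_def corner_state_def S_states_def grid_def
    by (simp split: if_splits) auto
  moreover have "strip_config n m r (i, j) \<noteq> quiescent \<longleftrightarrow> (i, j) \<in> grid n m" for i j
    by (auto simp: strip_config_def corner_state_def quiescent_def)
  ultimately show ?thesis by (auto simp: Config_def)
qed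

lemma ca_step_automaton:
  "ca_step (automaton X F) C (i, j) =
     (let s = C (i, j); s2 = C (i, j + 1); s3 = C (i, j - 1); s4 = C (i + 1, j); s5 = C (i - 1, j)
      in if blue X F s s2 s3 s4 s5 then add_label s (successor X F s s2 s3 s4 s5) else s)"
  by (simp add: ca_step_def automaton_def local_rule_def Let_def)

lemma ca_step_wrong_below:
  assumes "coord (C (i, j)) = Some (i, j)" "(i + 1, j) \<in> grid (length F) (length X)"
    and "coord (C (i + 1, j)) \<noteq> Some (i + 1, j)"
  shows "ca_step (automaton X F) C (i, j) = C (i, j)"
proof -
  have "\<not> blue X F (C (i, j)) s2 s3 (C (i + 1, j)) s5" for s2 s3 s5
    using assms by (auto simp: blue_def locally_correct_def Let_def)
  then show ?thesis by (simp add: ca_step_automaton Let_def)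
qed

text \<open>The successor is the right neighbour, so the new label is the sum mod 2 of
  \<open>j \<le> r\<close> and \<open>j + 1 \<le> r\<close>, which is 1 only at the end
  \<open>j = r\<close> of the labelled stretch.\<close>

lemma ca_step_strip_row0:
  assumes "1 \<le> j" "j \<le> int (length X)" "r < int (length X)" "F \<noteq> []"
  shows "ca_step (automaton X F) (strip_config (length F) (length X) r) (0, j) =
    State (Some (0, j)) None (Some False) None None (Some (j = r))"
proof -
  let ?C = "strip_config (length F) (length X) r"
  have n: "1 \<le> int (length F)" using assms(4) by (cases F) auto
  have s1: "?C (0, j) = State (Some (0, j)) None (Some False) None None (Some (j \<le> r))"
    using assms n by (simp add: strip_config_def grid_def)
  \<comment> \<open>For \<open>j = int (length X)\<close> the right neighbour is the end cell,
    labelled \<open>False\<close>; this equals \<open>j + 1 \<le> r\<close> because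
    \<open>r < int (length X)\<close>.\<close>
  have s2: "coord (?C (0, j + 1)) = Some (0, j + 1)" "label (?C (0, j + 1)) = Some (j + 1 \<le> r)"
    using assms n by (auto simp: strip_config_def grid_def)
  have s3: "coord (?C (0, j - 1)) = Some (0, j - 1)"
    using assms n by (auto simp: strip_config_def grid_def corner_state_def)
  have s4: "?C (1, j) = State (Some (1, j)) (Some 0) (Some False) (Some False) None (Some False)"
    using assms n by (simp add: strip_config_def grid_def)
  have s5: "?C (-1, j) = quiescent"
    by (simp add: strip_config_def grid_def)
  \<comment> \<open>In row 0 this amounts to correct coordinates around the cell and an equal
    assignment value below.\<close>
  have blue: "blue X F (?C (0, j)) (?C (0, j + 1)) (?C (0, j - 1)) (?C (1, j)) (?C (-1, j))"
    using assms n s2 s3 by (auto simp: blue_def locally_correct_def s1 s4 s5 grid_def quiescent_def)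
  have suc: "suc_coord (length F) (length X) (0, j) = (0, j + 1)"
    using assms by (simp add: suc_coord_def)
  have "successor X F (?C (0, j)) (?C (0, j + 1)) (?C (0, j - 1)) (?C (1, j)) (?C (-1, j))
      = ?C (0, j + 1)"
    unfolding successor_def using s2(1) s3
    by (intro the_equality) (auto simp: s1 s4 s5 suc quiescent_def)
  then show ?thesis
    using blue s2(2) by (auto simp: ca_step_automaton Let_def add_label_def s1)
qed

lemma ca_step_strip_cong:
  assumes "0 \<le> r" "r < int (length X)" "length F \<ge> 2" "p \<noteq> (0, r)"
  shows "ca_step (automaton X F) (strip_config (length F) (length X) r) p =
    ca_step (automaton X F) (strip_config (length F) (length X) 0) p"
proof -
  let ?C = "strip_config (length F) (length X)"
  obtain i j where p: "p = (i, j)" by fastforce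
  have same: "?C r (a, b) = ?C 0 (a, b)" if "\<not> (a = 0 \<and> 1 \<le> b \<and> b \<le> r)" for a b
    using that assms(1,2) by (auto simp: strip_config_def)
  consider "i = 0" "1 \<le> j" "j \<le> int (length X)"
    | "i = 0" "j = 0" | "i = 1" "1 \<le> j" "j \<le> int (length X)"
    | "(i, j) \<in> grid (length F) (length X)" "(i, j) \<noteq> (0, 0)"
        "\<not> (i \<in> {0, 1} \<and> 1 \<le> j \<and> j \<le> int (length X))"
    | "(i, j) \<notin> grid (length F) (length X)"
    by auto
  then show ?thesis
  proof cases
    \<comment> \<open>Both images have label \<open>False\<close> here: \<open>j \<noteq> r\<close>
      by assumption and \<open>j \<noteq> 0\<close> by the range of \<open>j\<close>.\<close>
    case 1
    have "F \<noteq> []" using assms(3) by auto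
    moreover have "0 < int (length X)" using assms(1,2) by linarith
    ultimately show ?thesis using 1 assms by (auto simp: p ca_step_strip_row0)
  next
    case 2
    \<comment> \<open>A blue \<open>(0, 0)\<close> would add the label of \<open>(0, 1)\<close>,
      which depends on \<open>r'\<close>; the wrong coordinates at \<open>(1, 0)\<close> prevent
      this.\<close>
    have "ca_step (automaton X F) (?C r') (0, 0) = ?C r' (0, 0)" for r'
      by (rule ca_step_wrong_below)
        (use assms(3) in \<open>simp_all add: strip_config_def grid_def corner_state_def\<close>)
    then show ?thesis using 2 same[of 0 0] by (simp add: p)
  next
    case 3
    \<comment> \<open>The second clause puts row 2 inside the grid, and \<open>(2, j)\<close> has
      wrong coordinates.\<close>
    have "ca_step (automaton X F) (?C r') (1, j) = ?C r' (1, j)" for r'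
      by (rule ca_step_wrong_below)
        (use assms(3) 3 in \<open>simp_all add: strip_config_def grid_def corner_state_def\<close>)
    then show ?thesis using 3 same[of 1 j] by (simp add: p)
  next
    case 4
    \<comment> \<open>None of the five cells lies in columns 1 to \<open>r\<close> of row 0. At the
      right end of row 0, whose left neighbour is in column \<open>int (length X)\<close>, this uses
      \<open>r < int (length X)\<close>.\<close>
    have "?C r (i, j) = ?C 0 (i, j)" "?C r (i, j + 1) = ?C 0 (i, j + 1)"
      "?C r (i, j - 1) = ?C 0 (i, j - 1)" "?C r (i + 1, j) = ?C 0 (i + 1, j)"
      "?C r (i - 1, j) = ?C 0 (i - 1, j)"
      by (rule same, use 4 assms(2) in \<open>auto simp: grid_def\<close>)+
    then show ?thesis by (simp add: p ca_step_automaton Let_def)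
  next
    case 5
    then have "?C r' (i, j) = quiescent" for r' by (simp add: strip_config_def)
    then show ?thesis
      by (simp add: p ca_step_automaton blue_def locally_correct_def Let_def)
  qed
qed

lemma inverse_ca_sees_strip:
  assumes B: "is_inverse_ca X F B" and "length F \<ge> 2" "1 \<le> r" "r < int (length X)"
  shows "(0, r - 1) \<in> set (nbhd B)"
proof (rule ccontr)
  assume notin: "(0, r - 1) \<notin> set (nbhd B)"
  let ?C = "strip_config (length F) (length X)"
  let ?A = "ca_step (automaton X F)"
  have inv: "ca_step B (?A (?C r')) = ?C r'" for r'
    using B strip_config_in_Config by (simp add: is_inverse_ca_def inverse_on_def)
  \<comment> \<open>The images can differ only at \<open>(0, r)\<close>, and from
    \<open>(0, 1)\<close> only the offset \<open>(0, r - 1)\<close> leads there.\<close>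
  have "?A (?C r) ((0, 1) + y) = ?A (?C 0) ((0, 1) + y)" if "y \<in> set (nbhd B)" for y
    using that notin assms(2-4) by (intro ca_step_strip_cong) (cases y; auto)+
  then have "ca_step B (?A (?C r)) (0, 1) = ca_step B (?A (?C 0)) (0, 1)"
    by (simp add: ca_step_def cong: map_cong)
  then have "?C r (0, 1) = ?C 0 (0, 1)" by (simp add: inv)
  then show False using assms(3,4) by (simp add: strip_config_def grid_def)
qed

text \<open>Each \<open>r\<close> from 1 to \<open>length X - 1\<close> forces its own offset
  \<open>(0, r - 1)\<close> into the neighbourhood.\<close>

lemma length_nbhd_inverse_ca:
  assumes "is_inverse_ca X F B" "length F \<ge> 2"
  shows "length X \<le> length (nbhd B) + 1"
proof -
  let ?f = "\<lambda>r::int. (0::int, r - 1)"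
  have "?f ` {1..<int (length X)} \<subseteq> set (nbhd B)"
    using inverse_ca_sees_strip[OF assms] by auto
  then have "card (?f ` {1..<int (length X)}) \<le> length (nbhd B)"
    by (meson card_length card_mono finite_set le_trans)
  moreover have "card (?f ` {1..<int (length X)}) = length X - 1"
    by (subst card_image) (auto simp: inj_on_def)
  ultimately show ?thesis by linarith
qed

text \<open>With at least two states, the table has at least \<open>2 ^ length (nbhd B)\<close> rows
  of at least one bit each.\<close>

lemma two_power_length_nbhd_le_ca_size:
  assumes "is_ca B" "card (states B) \<ge> 2"
  shows "2 ^ length (nbhd B) \<le> ca_size B"
proof -
  have "1 \<le> log 2 (real (card (states B)))"
    using assms(2) by (simp add: le_log_iff)
  then have "1 \<le> code_width (states B)"
    unfolding code_width_def by linarith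
  moreover have "2 ^ length (nbhd B) \<le> card (states B) ^ length (nbhd B)"
    using assms(2) by (intro power_mono) auto
  ultimately show ?thesis
    using mult_le_mono[of "2 ^ length (nbhd B)" _ 1] by (simp add: ca_size_eq[OF assms(1)])
qed

lemma card_S_states_ge_2:
  assumes "finite (S_states n m)"
  shows "2 \<le> card (S_states n m)"
proof -
  have "card {quiescent, corner_state} \<le> card (S_states n m)"
    using assms by (intro card_mono) (auto simp: S_states_def corner_state_def)
  then show ?thesis by (simp add: quiescent_def corner_state_def)
qed

text \<open>The clauses of pigeons 0 and 1 differ, and \<open>make_odd\<close> never shortens the
  list.\<close>

lemma length_php_clauses_ge_2:
  assumes "enumerates D (not_onto_php k)" "1 \<le> k"
  shows "2 \<le> length (make_odd D)"
proof -
  let ?c = "\<lambda>i::nat. {Pos (i, j) |j. j < k}"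
  have "?c i \<in> not_onto_php k" if "i < k + 1" for i
    unfolding not_onto_php_def using that by (intro UnI1) blast
  from this[of 0] this[of 1] have sub: "{?c 0, ?c 1} \<subseteq> set D"
    using assms by (simp add: enumerates_def)
  have "Pos (0, 0) \<in> ?c 0" "Pos (0, 0) \<notin> ?c 1"
    using assms(2) by auto
  then have "?c 0 \<noteq> ?c 1" by metis
  then have "2 = card {?c 0, ?c 1}" by simp
  also have "\<dots> \<le> length D"
    using sub by (meson card_length card_mono finite_set le_trans)
  finally show ?thesis by (simp add: make_odd_def)
qed

lemma length_php_vars:
  assumes "enumerates X (php_vars k)"
  shows "length X = (k + 1) * k"
  using assms distinct_card[of X] by (simp add: enumerates_def php_vars_def)

theorem theorem7p4:
  fixes X :: "nat \<Rightarrow> (nat \<times> nat) list"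
    and D :: "nat \<Rightarrow> (nat \<times> nat) clause list"
  assumes "\<And>k. enumerates (X k) (php_vars k)"
    and "\<And>k. enumerates (D k) (not_onto_php k)"
  shows "\<exists>\<epsilon>::real. \<epsilon> > 0 \<and>
    (\<forall>\<^sub>F k in sequentially. \<forall>B. is_inverse_ca (X k) (make_odd (D k)) B \<longrightarrow>
       real (ca_size B) \<ge> 2 powr (real k powr \<epsilon>)) \<and>
    (\<forall>\<^sub>F k in sequentially. \<forall>B. is_inverse_ca (X k) (make_odd (D k)) B \<longrightarrow>
       real (length (nbhd B)) \<ge> real k powr \<epsilon>)"
proof -
  have nbhd: "k \<le> length (nbhd B)"
    if "1 \<le> k" "is_inverse_ca (X k) (make_odd (D k)) B" for k B
  proof -
    \<comment> \<open>There are \<open>(k + 1) * k\<close> variables; the lost 1 is absorbed by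
      \<open>k * k\<close>.\<close>
    have "k * k + k \<le> length (nbhd B) + 1"
      using length_nbhd_inverse_ca[OF that(2) length_php_clauses_ge_2[OF assms(2) that(1)]]
      by (simp add: length_php_vars[OF assms(1)])
    moreover have "1 \<le> k * k" using that(1) by simp
    ultimately show ?thesis by linarith
  qed
  have size: "2 powr real k \<le> real (ca_size B)"
    if "1 \<le> k" "is_inverse_ca (X k) (make_odd (D k)) B" for k B
  proof -
    have ca: "is_ca B" and st: "states B = S_states (length (make_odd (D k))) (length (X k))"
      using that(2) by (simp_all add: is_inverse_ca_def)
    then have "2 \<le> card (states B)"
      using card_S_states_ge_2 by (simp add: is_ca_def)
    then have "2 ^ k \<le> ca_size B"
      using two_power_length_nbhd_le_ca_size[OF ca] nbhd[OF that]
      by (meson le_trans one_le_numeral power_increasing)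
    then have "real (2 ^ k) \<le> real (ca_size B)"
      by (rule of_nat_mono)
    then show ?thesis by (simp add: powr_realpow)
  qed
  have "\<forall>\<^sub>F k in sequentially. \<forall>B. is_inverse_ca (X k) (make_odd (D k)) B \<longrightarrow>
       2 powr (real k powr 1) \<le> real (ca_size B)"
    using eventually_ge_at_top[of 1] by eventually_elim (simp add: size)
  moreover have "\<forall>\<^sub>F k in sequentially. \<forall>B. is_inverse_ca (X k) (make_odd (D k)) B \<longrightarrow>
       real k powr 1 \<le> real (length (nbhd B))"
    using eventually_ge_at_top[of 1] by eventually_elim (simp add: nbhd)
  ultimately show ?thesis by (intro exI[of _ 1]) auto
qed

end
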